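(* Let $n \ge 1$ and consider an additive frieze ("pavage additif") with $n+1$ lines, with entries $a_{r\ldots s}$ (where $a_{r\ldots r}=a_r$). Then for all integers $r,s$ with $s>r$ (and $s-r+1\le n$, so that the entries below belong to the frieze): (a) $a_s = a_{r\ldots s}-a_{r\ldots s-1}+(s-r)$; (b) $a_r = a_{r\ldots s}-a_{r+1\ldots s}+(s-r)$.
   Context: An additive frieze (pavage additif) with $n+1$ lines is an array of real numbers arranged in $n+1$ bi-infinite lines, numbered $0,1,\ldots,n$ from top to bottom, each line being shifted by half a position with respect to the previous one (like bricks in a wall), such that line $0$ and line $n$ consist only of $0$s and every elementary diamond with top $a$, left $b$, right $c$, bottom $d$ satisfies $(b+c)-(a+d)=1$. Notation for the entries: line $1$ is $(a_i)_{i\in\mathbb{Z}}$; for $1\le k\le n$, the entries of line $k$ are denoted $a_{r\ldots s}$ with $r,s\in\mathbb{Z}$ and $s-r+1=k$ (the subscript $r\ldots s$ abbreviates the list of consecutive indices $r,r+1,\ldots,s$, and $a_{r\ldots r}=a_r$). The entry $a_{r\ldots s}$ with $r<s$ is the bottom of the diamond whose left entry is $a_{r\ldots s-1}$, whose right entry is $a_{r+1\ldots s}$, and whose top entry is $a_{r+1\ldots s-1}$ (this top entry being the entry $0$ of line $0$ when $s=r+1$). Thus the diamond rule reads $a_{r\ldots s-1}+a_{r+1\ldots s}-a_{r+1\ldots s-1}-a_{r\ldots s}=1$ for all $r<s$ with $s-r+1\le n$, and $a_{r\ldots s}=0$ whenever $s-r+1=n$. *)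

theory Defs
  imports Complex_Main
begin

text \<open>
  An array with lines \<open>0, \<dots>, n\<close> is encoded as a function \<open>a\<close> on pairs of integers:
  \<open>a r s\<close> is the entry of line \<open>s - r + 1\<close> attached to the (possibly empty) list of
  consecutive indices \<open>r, r + 1, \<dots>, s\<close>. Thus line \<open>0\<close> consists of the entries
  \<open>a r (r - 1)\<close>, line \<open>1\<close> of the entries \<open>a r r\<close>, and line \<open>n\<close> of the entries
  \<open>a r (r + n - 1)\<close>. Values \<open>a r s\<close> with \<open>s - r + 1 < 0\<close> or \<open>s - r + 1 > n\<close> do not belong
  to the array and are unconstrained.
\<close>

text \<open>The arguments are the top, left, right and bottom entries, in this order.\<close>

definition diamond_rule :: "real \<Rightarrow> real \<Rightarrow> real \<Rightarrow> real \<Rightarrow> bool" where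
  "diamond_rule t l r b \<longleftrightarrow> (l + r) - (t + b) = 1"

definition additive_frieze :: "nat \<Rightarrow> (int \<Rightarrow> int \<Rightarrow> real) \<Rightarrow> bool" where
  "additive_frieze n a \<longleftrightarrow>
     (\<forall>r s. s - r + 1 = 0 \<longrightarrow> a r s = 0) \<and>
     (\<forall>r s. s - r + 1 = int n \<longrightarrow> a r s = 0) \<and>
     (\<forall>r s. r < s \<and> s - r + 1 \<le> int n \<longrightarrow>
        diamond_rule (a (r + 1) (s - 1)) (a r (s - 1)) (a (r + 1) s) (a r s))"

end

theory Submission
  imports Defs
begin

text \<open>
  Read along a diagonal, the diamond rule is a telescoping recurrence. For fixed \<open>s\<close>, put
  \<open>D r = a r s - a r (s - 1)\<close>, the jump between two neighbouring diagonals. The diamond with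
  bottom \<open>a r s\<close> says exactly \<open>D r = D (r + 1) - 1\<close>, and at the top of the diagonals
  \<open>D s = a s s\<close> because line \<open>0\<close> vanishes. Hence \<open>D r = a s s - (s - r)\<close>, which is the first
  identity. The second one is the mirror image, with \<open>r\<close> fixed and the jump
  \<open>a r s - a (r + 1) s\<close> decreasing by \<open>1\<close> whenever \<open>s\<close> increases by \<open>1\<close>.
\<close>

lemma additive_frieze_line_0:
  assumes "additive_frieze n a"
  shows "a r (r - 1) = 0"
  using assms by (simp add: additive_frieze_def)

lemma additive_frieze_diamond:
  assumes "additive_frieze n a" "r < s" "s - r + 1 \<le> int n"
  shows "a r (s - 1) + a (r + 1) s - (a (r + 1) (s - 1) + a r s) = 1"
  using assms by (simp add: additive_frieze_def diamond_rule_def)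

text \<open>
  Both inductions start at \<open>r = s\<close>, on line \<open>1\<close>, where the subtracted entry lies on line \<open>0\<close>.
\<close>

lemma additive_frieze_last_index:
  assumes frieze: "additive_frieze n a" and "r \<le> s" "s - r + 1 \<le> int n"
  shows "a s s = a r s - a r (s - 1) + real_of_int (s - r)"
  using assms(2,3)
proof (induction r rule: int_le_induct)
  case base
  then show ?case
    using additive_frieze_line_0[OF frieze, of s] by simp
next
  case (step r)
  then show ?case
    using additive_frieze_diamond[OF frieze, of "r - 1" s] by simp
qed

lemma additive_frieze_first_index:
  assumes frieze: "additive_frieze n a" and "r \<le> s" "s - r + 1 \<le> int n"
  shows "a r r = a r s - a (r + 1) s + real_of_int (s - r)"
  using assms(2,3)
proof (induction s rule: int_ge_induct)
  case base
  then show ?case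
    using additive_frieze_line_0[OF frieze, of "r + 1"] by simp
next
  case (step s)
  then show ?case
    using additive_frieze_diamond[OF frieze, of r "s + 1"] by simp
qed

theorem mainTheorem1:
  fixes n :: nat and a :: "int \<Rightarrow> int \<Rightarrow> real" and r s :: int
  assumes "n \<ge> 1"
    and "additive_frieze n a"
    and "r < s"
    and "s - r + 1 \<le> int n"
  shows "a s s = a r s - a r (s - 1) + real_of_int (s - r) \<and>
         a r r = a r s - a (r + 1) s + real_of_int (s - r)"
  using assms additive_frieze_last_index[of n a r s] additive_frieze_first_index[of n a r s]
  by simp

end
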